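(* Let $(V_t)_{t\ge0}$ be probability mass functions on $\mathbb{Z}_+=\{0,1,2,\dots\}$ with $V_t(x)>0$ for all $x$, and $(g_t)_{t\ge0}$ real-valued functions on $\mathbb{Z}_+$, such that for some $\alpha_t>0$ and all $x\in\mathbb{Z}_+$, $t\ge0$, $$\frac{\partial}{\partial t}V_t(x)=\alpha_t\bigl(V_t(x)-V_t(x-1)\bigr),\qquad \frac{\partial}{\partial t}g_t(x)=\alpha_t\frac{V_t(x-1)}{V_t(x)}\bigl(g_t(x)-g_t(x-1)\bigr).$$ Suppose that for each $t$ there is a constant $c_t>0$ such that for all $f:\mathbb{Z}_+\to(0,\infty)$ with $\sum_xV_t(x)f(x)<\infty$, $$\mathrm{Ent}_{V_t}(f)\le\frac1{c_t}\sum_{x=0}^\infty V_t(x)\,f(x+1)\left(\log\left(\frac{f(x+1)}{f(x)}\right)-1+\frac{f(x)}{f(x+1)}\right).$$ Let $p>0$, and write $V=V_0$, $g=g_0$, $q(t)=p\exp\left(-\int_0^t\alpha_sc_s\,ds\right)$. Then for all $t\ge0$, $$\|\exp(g)\|_{V,p}\le\|\exp(g_t)\|_{V_t,q(t)}.$$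
   Context: Convention: $V_t(-1)=0$, and any term multiplied by $V_t(-1)$ is $0$. For a probability mass function $U$ on $\mathbb{Z}_+$, $r>0$ and $f:\mathbb{Z}_+\to(0,\infty)$, $\|f\|_{U,r}=\left(\sum_{x=0}^\infty U(x)f(x)^r\right)^{1/r}$. For $f:\mathbb{Z}_+\to(0,\infty)$ with $\mu_{U,f}=\sum_xU(x)f(x)<\infty$, $$\mathrm{Ent}_U(f)=\sum_{x=0}^\infty U(x)f(x)\log f(x)-\mu_{U,f}\log\mu_{U,f}.$$ The functions $t\mapsto\alpha_t$ and $t\mapsto c_t$ are assumed regular enough (e.g. continuous) for $\int_0^t\alpha_sc_s\,ds$ to make sense. *)

theory Defs
  imports "HOL-Probability.Probability"
begin

(* The shift x |-> u (x - 1), with the convention u (-1) = 0 at x = 0. *)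
definition shift_down :: "(nat \<Rightarrow> real) \<Rightarrow> nat \<Rightarrow> real" where
  "shift_down u x = (if x = 0 then 0 else u (x - 1))"

(* Real power on [0, \<infinity>], intended for r > 0 only: \<infinity> is sent to \<infinity>. *)
definition ennreal_powr :: "ennreal \<Rightarrow> real \<Rightarrow> ennreal" where
  "ennreal_powr a r = (if a = \<top> then \<top> else ennreal (enn2real a powr r))"

(* The norm takes values in [0, \<infinity>], so that a divergent series gives the norm \<infinity>. *)
definition pmf_norm :: "nat pmf \<Rightarrow> real \<Rightarrow> (nat \<Rightarrow> real) \<Rightarrow> ennreal" where
  "pmf_norm U r f = ennreal_powr (\<Sum>x. ennreal (pmf U x * f x powr r)) (1 / r)"

definition pmf_mean :: "nat pmf \<Rightarrow> (nat \<Rightarrow> real) \<Rightarrow> real" where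
  "pmf_mean U f = (\<Sum>x. pmf U x * f x)"

(* Intended for positive f with finite mean. The signed series is taken in the extended
   reals; it always converges there (pmf_Ent_series_converges), possibly to \<infinity>. *)
definition pmf_Ent :: "nat pmf \<Rightarrow> (nat \<Rightarrow> real) \<Rightarrow> ereal" where
  "pmf_Ent U f = (\<Sum>x. ereal (pmf U x * f x * ln (f x)))
                   - ereal (pmf_mean U f * ln (pmf_mean U f))"

lemma pmf_Ent_series_converges:
  fixes U :: "nat pmf" and f :: "nat \<Rightarrow> real"
  assumes pos: "\<And>x. f x > 0"
  shows "summable (\<lambda>x. ereal (pmf U x * f x * ln (f x)))"
proof -
  define a where "a x = pmf U x * f x * ln (f x)" for x
  have lb: "a x + pmf U x \<ge> 0" for x
  proof -
    have "ln (1 / f x) \<le> 1 / f x - 1" using pos[of x] by (intro ln_le_minus_one) simp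
    then have "f x * (- ln (f x)) \<le> f x * (1 / f x - 1)"
      using pos[of x] by (intro mult_left_mono) (simp_all add: ln_div)
    then have "f x * ln (f x) + 1 \<ge> 0" using pos[of x] by (simp add: algebra_simps)
    then have "pmf U x * (f x * ln (f x) + 1) \<ge> 0" by (intro mult_nonneg_nonneg) auto
    then show ?thesis by (simp add: a_def algebra_simps)
  qed
  have s: "summable (pmf U)"
    using integrable_pmf[of UNIV U] by (simp add: integrable_count_space_nat_iff)
  let ?L = "\<Sum>x. ereal (a x + pmf U x)"
  have 1: "(\<lambda>n. \<Sum>i<n. ereal (a i + pmf U i)) \<longlonglongrightarrow> ?L"
    by (rule summable_LIMSEQ[OF summable_ereal_pos]) (use lb in simp)
  have 2: "(\<lambda>n. ereal (\<Sum>i<n. pmf U i)) \<longlonglongrightarrow> ereal (\<Sum>i. pmf U i)"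
    using summable_LIMSEQ[OF s] by simp
  have "(\<lambda>n. (\<Sum>i<n. ereal (a i + pmf U i)) - ereal (\<Sum>i<n. pmf U i))
          \<longlonglongrightarrow> ?L - ereal (\<Sum>i. pmf U i)"
    by (rule tendsto_diff_ereal_general[OF 1 2]) auto
  moreover have "(\<Sum>i<n. ereal (a i + pmf U i)) - ereal (\<Sum>i<n. pmf U i)
                   = (\<Sum>i<n. ereal (a i))" for n
    by (simp add: sum.distrib)
  ultimately have "(\<lambda>x. ereal (a x)) sums (?L - ereal (\<Sum>i. pmf U i))"
    by (simp add: sums_def)
  then show ?thesis by (auto simp: summable_def a_def)
qed

end

theory Submission
  imports Defs
begin

text \<open>
  Write \<open>f = exp (q g\<^sub>t)\<close>, \<open>F = \<Sum> V\<^sub>t f\<close> and let \<open>D\<close> be the series on the right of the logarithmic Sobolev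
  inequality. The equation for \<open>g\<^sub>t\<close> is chosen so that, for a fixed exponent \<open>q\<close>, the time
  derivative of \<open>F\<close> is \<open>\<alpha>\<^sub>t D\<close>. Moreover \<open>q\<^sup>2 F\<close> times the derivative of \<open>(1/q) ln F\<close> in \<open>q\<close> is the
  entropy of \<open>f\<close>. Along \<open>q' = -\<alpha> c q\<close> the derivative of \<open>(1/q) ln F\<close>, the logarithm of the norm, is
  therefore \<open>\<alpha>/(q F) (D - c Ent f)\<close>, which is nonnegative. Two points need care.

  First, \<open>\<alpha> c\<close> is merely integrable, so the exponent solves its differential equation only in the
  integrated sense. The logarithm of the norm is differentiable as a function of the two variables
  time and \<open>u = \<integral> \<alpha> c\<close>, and \<open>le_along_indefinite_integral\<close> draws the conclusion from there:
  Henstock's lemma lets the gauge of the integral and the radii of differentiability be served by one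
  tagged division, over which the increments of the function are summed.

  Second, the series have to be differentiated termwise, which is safe only when \<open>g\<close> is
  bounded. Up to a factor depending only on time, both \<open>V\<^sub>t\<close> and the product \<open>V\<^sub>t g\<^sub>t\<close> are convolved
  with a Poisson weight as time runs backwards. So, for \<open>s \<le> T\<close>, the value \<open>g\<^sub>s(x)\<close> is the conditional
  expectation of \<open>g\<^sub>T(Y)\<close> given \<open>Y + N = x\<close>, where \<open>Y\<close> has law \<open>V\<^sub>T\<close> and \<open>N\<close> is an independent
  Poisson variable. Replacing \<open>g\<^sub>T\<close> by \<open>0\<close> beyond \<open>n\<close> hence produces a bounded solution
  (\<open>bounded_flow_truncated\<close>) that agrees with \<open>g\<close> on \<open>{0..n}\<close> at all times (\<open>truncated_eq\<close>), because
  \<open>Y \<le> Y + N\<close>. The bounded case (\<open>exponential_moment_le_if_bounded\<close>) then controls the first \<open>n + 1\<close>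
  terms of the series at time \<open>0\<close>, and \<open>n\<close> tends to infinity.
\<close>
section \<open>Monotonicity along an indefinite integral and termwise differentiation\<close>
text \<open>
  Formally this is the chain rule: with \<open>U\<close> the indefinite integral of \<open>k\<close>, the function
  \<open>s \<mapsto> \<Theta> (s, U s)\<close> has derivative \<open>P + k Q\<close>. But \<open>U\<close> need not be differentiable with derivative \<open>k\<close> at
  every point. On an interval tagged at \<open>s\<close> the increment of \<open>\<Theta>\<close> differs from
  \<open>(P s + k s Q s) (r - l)\<close> by \<open>Q s\<close> times the local Riemann error of \<open>k\<close>, whose total is small by
  Henstock's lemma, and by a small multiple of \<open>(r - l) + (U r - U l)\<close>, whose total is controlled
  since \<open>U\<close> is increasing.
\<close>
lemma le_along_indefinite_integral:
  fixes \<Theta> :: "real \<times> real \<Rightarrow> real" and k P Q :: "real \<Rightarrow> real"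
  assumes ab: "a \<le> b"
    and k_int: "k integrable_on {a..b}"
    and k_nonneg: "\<And>s. s \<in> {a..b} \<Longrightarrow> k s \<ge> 0"
    and deriv: "\<And>s. s \<in> {a..b} \<Longrightarrow>
        (\<Theta> has_derivative (\<lambda>z. P s * fst z + Q s * snd z))
          (at (s, integral {a..s} k) within {a..b} \<times> UNIV)"
    and Q_bound: "\<And>s. s \<in> {a..b} \<Longrightarrow> \<bar>Q s\<bar> \<le> C"
    and nonneg: "\<And>s. s \<in> {a..b} \<Longrightarrow> P s + k s * Q s \<ge> 0"
  shows "\<Theta> (a, 0) \<le> \<Theta> (b, integral {a..b} k)"
proof -
  define U where "U s = integral {a..s} k" for s
  define \<phi> where "\<phi> s = \<Theta> (s, U s)" for s
  have C: "C \<ge> 0" using Q_bound[of a] ab by force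
  have U_diff: "U r - U l = integral {l..r} k" if "a \<le> l" "l \<le> r" "r \<le> b" for l r
  proof -
    have "k integrable_on {a..r}"
      using integrable_on_subinterval[OF k_int, of a r] that by auto
    then show ?thesis
      using Henstock_Kurzweil_Integration.integral_combine[of a l r k] that by (simp add: U_def)
  qed
  have U_mono: "U l \<le> U r" if "a \<le> l" "l \<le> r" "r \<le> b" for l r
  proof -
    have "integral {l..r} k \<ge> 0"
      using integrable_on_subinterval[OF k_int, of l r] k_nonneg that
      by (intro Henstock_Kurzweil_Integration.integral_nonneg) auto
    then show ?thesis using U_diff[OF that] by simp
  qed
  have U_cont: "continuous_on {a..b} U"
    unfolding U_def by (rule indefinite_integral_continuous_1[OF k_int])
  \<comment> \<open>The constant collects the three errors: Riemann error, length, and increase of \<open>U\<close>.\<close>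
  have almost: "\<phi> b - \<phi> a \<ge> - (e * (C + (b - a) + U b))" if e: "e > 0" for e
  proof -
    have "\<exists>d>0. \<forall>t\<in>{a..b}. \<bar>t - s\<bar> < d \<longrightarrow>
        \<bar>\<phi> t - \<phi> s - (P s * (t - s) + Q s * (U t - U s))\<bar> \<le> e * (\<bar>t - s\<bar> + \<bar>U t - U s\<bar>)"
      if s: "s \<in> {a..b}" for s
    proof -
      from deriv[OF s] e obtain d where d: "d > 0" and
        D: "\<And>z. z \<in> {a..b} \<times> UNIV \<Longrightarrow> norm (z - (s, U s)) < d \<Longrightarrow>
          norm (\<Theta> z - \<Theta> (s, U s) - (P s * fst (z - (s, U s)) + Q s * snd (z - (s, U s))))
            \<le> e * norm (z - (s, U s))"
        unfolding has_derivative_within_alt U_def[symmetric] by blast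
      have "continuous_on {a..b} (\<lambda>t. (t, U t))"
        by (intro continuous_intros U_cont)
      then obtain d' where d': "d' > 0" and
        D': "\<And>t. t \<in> {a..b} \<Longrightarrow> dist t s < d' \<Longrightarrow> dist (t, U t) (s, U s) < d"
        using s d unfolding continuous_on_iff by blast
      show ?thesis
      proof (intro exI[of _ d'] conjI ballI impI d')
        fix t assume t: "t \<in> {a..b}" "\<bar>t - s\<bar> < d'"
        then have "norm ((t, U t) - (s, U s)) < d"
          using D'[of t] by (simp add: dist_norm)
        then have "\<bar>\<phi> t - \<phi> s - (P s * (t - s) + Q s * (U t - U s))\<bar>
            \<le> e * norm ((t - s, U t - U s))"
          using D[of "(t, U t)"] t by (simp add: \<phi>_def)
        also have "\<dots> \<le> e * (\<bar>t - s\<bar> + \<bar>U t - U s\<bar>)"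
          using e norm_Pair_le[of "t - s" "U t - U s"] by simp
        finally show "\<bar>\<phi> t - \<phi> s - (P s * (t - s) + Q s * (U t - U s))\<bar>
            \<le> e * (\<bar>t - s\<bar> + \<bar>U t - U s\<bar>)" .
      qed
    qed
    then obtain d where d: "\<And>s. s \<in> {a..b} \<Longrightarrow> d s > 0"
      and D: "\<And>s t. s \<in> {a..b} \<Longrightarrow> t \<in> {a..b} \<Longrightarrow> \<bar>t - s\<bar> < d s \<Longrightarrow>
        \<bar>\<phi> t - \<phi> s - (P s * (t - s) + Q s * (U t - U s))\<bar> \<le> e * (\<bar>t - s\<bar> + \<bar>U t - U s\<bar>)"
      by metis
    obtain \<gamma> where \<gamma>: "gauge \<gamma>" and
      H: "\<And>p. p tagged_partial_division_of (cbox a b) \<Longrightarrow> \<gamma> fine p \<Longrightarrow>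
             (\<Sum>(s, K)\<in>p. norm (measure lborel K *\<^sub>R k s - integral K k)) < e"
      using Henstock_lemma[of k a b e] k_int e by (auto simp: cbox_interval)
    define d1 where "d1 s = (if s \<in> {a..b} then d s else 1)" for s
    have "gauge (\<lambda>s. ball s (d1 s))"
      using d by (intro gauge_ball_dependent) (auto simp: d1_def)
    then have "gauge (\<lambda>s. ball s (d1 s) \<inter> \<gamma> s)"
      using \<gamma> by (rule gauge_Int)
    then obtain p where p: "p tagged_division_of {a..b}"
      and fine: "(\<lambda>s. ball s (d1 s) \<inter> \<gamma> s) fine p"
      using fine_division_exists_real by blast
    have fine1: "(\<lambda>s. ball s (d1 s)) fine p" and fine2: "\<gamma> fine p"
      using fine by (auto simp: fine_Int)
    have small: "(\<Sum>(s, K)\<in>p. \<bar>measure lborel K * k s - integral K k\<bar>) < e"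
      using H[of p] p fine2 by (simp add: cbox_interval tagged_division_of_def)
    \<comment> \<open>Differentiability is only known at the tag, so each interval is split there.\<close>
    have piece: "\<phi> (Sup K) - \<phi> (Inf K) \<ge> - C * \<bar>measure lborel K * k s - integral K k\<bar>
         - e * (Sup K - Inf K) - e * (U (Sup K) - U (Inf K))" if sK: "(s, K) \<in> p" for s K
    proof -
      obtain l r where K: "K = cbox l r" using p sK by blast
      have "s \<in> K" "K \<subseteq> {a..b}" using p sK by blast+
      then have lr: "a \<le> l" "l \<le> s" "s \<le> r" "r \<le> b" and s: "s \<in> {a..b}"
        using K by auto
      have "K \<subseteq> ball s (d1 s)" using fine1 sK by (auto simp: fine_def)
      moreover have "l \<in> K" "r \<in> K" using lr K by auto
      ultimately have "l \<in> ball s (d s)" "r \<in> ball s (d s)"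
        using s by (auto simp: d1_def)
      then have near: "\<bar>l - s\<bar> < d s" "\<bar>r - s\<bar> < d s" by (auto simp: dist_real_def)
      have sup: "Sup K = r" and inf: "Inf K = l" and cont: "measure lborel K = r - l"
        and int: "integral K k = U r - U l"
        using K lr U_diff[of l r] by auto
      have 1: "\<phi> r - \<phi> s \<ge> P s * (r - s) + Q s * (U r - U s) - e * ((r - s) + (U r - U s))"
        using D[OF s, of r] near lr U_mono[of s r] by (auto simp: abs_le_iff)
      have 2: "\<phi> s - \<phi> l \<ge> P s * (s - l) + Q s * (U s - U l) - e * ((s - l) + (U s - U l))"
        using D[OF s, of l] near lr U_mono[of l s] by (auto simp: abs_le_iff algebra_simps)
      have 3: "(P s + k s * Q s) * (r - l) \<ge> 0"
        using nonneg[OF s] lr by (intro mult_nonneg_nonneg) auto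
      have "\<bar>Q s * ((r - l) * k s - (U r - U l))\<bar> \<le> C * \<bar>(r - l) * k s - (U r - U l)\<bar>"
        unfolding abs_mult using Q_bound[OF s] by (intro mult_right_mono) auto
      then have 4: "Q s * (U r - U l) - Q s * ((r - l) * k s) \<ge> - C * \<bar>(r - l) * k s - (U r - U l)\<bar>"
        by (simp add: algebra_simps abs_le_iff)
      show ?thesis
        unfolding sup inf cont int using 1 2 3 4 by (simp add: algebra_simps)
    qed
    have "\<phi> b - \<phi> a = (\<Sum>(s, K)\<in>p. \<phi> (Sup K) - \<phi> (Inf K))"
      using additive_tagged_division_1[OF ab p, of \<phi>] by simp
    also have "\<dots> \<ge> (\<Sum>(s, K)\<in>p. - C * \<bar>measure lborel K * k s - integral K k\<bar>
         - e * (Sup K - Inf K) - e * (U (Sup K) - U (Inf K)))"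
      using piece by (intro sum_mono) auto
    also have "(\<Sum>(s, K)\<in>p. - C * \<bar>measure lborel K * k s - integral K k\<bar>
         - e * (Sup K - Inf K) - e * (U (Sup K) - U (Inf K)))
        = - C * (\<Sum>(s, K)\<in>p. \<bar>measure lborel K * k s - integral K k\<bar>)
          - e * (\<Sum>(s, K)\<in>p. Sup K - Inf K) - e * (\<Sum>(s, K)\<in>p. U (Sup K) - U (Inf K))"
      by (simp add: sum_distrib_left sum_subtractf[symmetric] case_prod_unfold sum_negf[symmetric])
    also have "\<dots> = - C * (\<Sum>(s, K)\<in>p. \<bar>measure lborel K * k s - integral K k\<bar>)
          - e * (b - a) - e * (U b - U a)"
      using additive_tagged_division_1[OF ab p, of "\<lambda>x. x"]
        additive_tagged_division_1[OF ab p, of U] by simp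
    finally have "\<phi> b - \<phi> a \<ge> - C * (\<Sum>(s, K)\<in>p. \<bar>measure lborel K * k s - integral K k\<bar>)
          - e * (b - a) - e * (U b - U a)" .
    moreover have "C * (\<Sum>(s, K)\<in>p. \<bar>measure lborel K * k s - integral K k\<bar>) \<le> C * e"
      using small C by (intro mult_left_mono) auto
    moreover have "U a = 0" by (simp add: U_def)
    ultimately show ?thesis by (simp add: algebra_simps)
  qed
  have "\<phi> a \<le> \<phi> b"
  proof (rule ccontr)
    assume neg: "\<not> \<phi> a \<le> \<phi> b"
    define m where "m = C + (b - a) + U b"
    have "U a = 0" by (simp add: U_def)
    then have m: "m \<ge> 0" using C ab U_mono[of a b] by (simp add: m_def)
    define e where "e = (\<phi> a - \<phi> b) / (m + 1)"
    have "e > 0" using neg m by (simp add: e_def)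
    then have "\<phi> a - \<phi> b \<le> e * m" using almost[of e] by (simp add: m_def)
    moreover have "e * (m + 1) = \<phi> a - \<phi> b" using m by (simp add: e_def)
    ultimately show False using \<open>e > 0\<close> by (simp add: algebra_simps)
  qed
  then show ?thesis by (simp add: \<phi>_def U_def)
qed

text \<open>
  The difference quotients of the terms are dominated by \<open>B\<close>, hence so are the remainders of the linear
  approximations, and Tannery's theorem exchanges the limit and the sum.
\<close>
lemma has_derivative_suminf_dominated:
  fixes F :: "nat \<Rightarrow> 'a::real_normed_vector \<Rightarrow> real"
  assumes deriv: "\<And>n. (F n has_derivative F' n) (at z within S)"
    and lipschitz: "\<forall>\<^sub>F w in at z within S. \<forall>n. \<bar>F n w - F n z\<bar> \<le> B n * norm (w - z)"
    and F'_bound: "\<And>n h. \<bar>F' n h\<bar> \<le> B n * norm h"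
    and B: "summable B"
    and F_summable: "\<And>w. w \<in> S \<Longrightarrow> summable (\<lambda>n. F n w)" "summable (\<lambda>n. F n z)"
  shows "((\<lambda>w. \<Sum>n. F n w) has_derivative (\<lambda>h. \<Sum>n. F' n h)) (at z within S)"
proof -
  have lin: "bounded_linear (F' n)" for n using deriv[of n] by (rule has_derivative_bounded_linear)
  have sF': "summable (\<lambda>n. F' n h)" for h
    by (rule summable_comparison_test'[OF summable_mult2[OF B, of "norm h"], of 0])
      (use F'_bound in auto)
  have bl: "bounded_linear (\<lambda>h. \<Sum>n. F' n h)"
  proof (rule bounded_linear_intro)
    show "(\<Sum>n. F' n (x + y)) = (\<Sum>n. F' n x) + (\<Sum>n. F' n y)" for x y
      by (simp add: suminf_add[OF sF' sF'] linear_add[OF bounded_linear.linear[OF lin]])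
    show "(\<Sum>n. F' n (r *\<^sub>R x)) = r *\<^sub>R (\<Sum>n. F' n x)" for r x
      by (simp add: suminf_mult[OF sF'] linear_scale[OF bounded_linear.linear[OF lin]])
    show "norm (\<Sum>n. F' n x) \<le> norm x * (\<Sum>n. B n)" for x
    proof -
      have "norm (\<Sum>n. F' n x) \<le> (\<Sum>n. B n * norm x)"
        by (rule norm_suminf_le) (use F'_bound summable_mult2[OF B] in auto)
      then show ?thesis by (simp add: suminf_mult2[OF B, symmetric] mult.commute)
    qed
  qed
  define R where "R n w = (1 / norm (w - z)) *\<^sub>R (F n w - (F n z + F' n (w - z)))" for n w
  have R_lim: "(R n \<longlongrightarrow> 0) (at z within S)" for n
    using deriv[of n] unfolding has_derivative_within R_def by blast
  have neq: "\<forall>\<^sub>F w in at z within S. w \<in> S \<and> w \<noteq> z"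
    by (simp add: eventually_at_filter)
  have R_bound: "\<forall>\<^sub>F w in at z within S. \<forall>n. norm (R n w) \<le> 2 * B n"
    using eventually_conj[OF lipschitz neq]
  proof (rule eventually_mono, intro allI)
    fix w n
    assume w: "(\<forall>n. \<bar>F n w - F n z\<bar> \<le> B n * norm (w - z)) \<and> w \<in> S \<and> w \<noteq> z"
    have "\<bar>F n w - (F n z + F' n (w - z))\<bar> \<le> 2 * B n * norm (w - z)"
      using w[THEN conjunct1, rule_format, of n] F'_bound[of n "w - z"] by linarith
    then show "norm (R n w) \<le> 2 * B n"
      using w by (simp add: R_def divide_le_eq)
  qed
  have R_sum: "(\<Sum>n. R n w) = (1 / norm (w - z)) *\<^sub>R
      ((\<Sum>n. F n w) - ((\<Sum>n. F n z) + (\<Sum>n. F' n (w - z))))" if "w \<in> S" for w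
    unfolding R_def
    by (simp only: suminf_add[OF F_summable(2) sF'] summable_add[OF F_summable(2) sF']
        suminf_diff[OF F_summable(1)[OF that] summable_add[OF F_summable(2) sF']]
        real_scaleR_def suminf_mult[OF summable_diff[OF F_summable(1)[OF that]
          summable_add[OF F_summable(2) sF']]])
  have "((\<lambda>w. \<Sum>n. R n w) \<longlongrightarrow> 0) (at z within S)"
  proof (cases "at z within S = bot")
    case False
    have "\<forall>\<^sub>F (n, w) in at_top \<times>\<^sub>F (at z within S). norm (R n w) \<le> 2 * B n"
      unfolding eventually_prod_filter
      by (rule exI[of _ "\<lambda>_. True"], rule exI[of _ "\<lambda>w. \<forall>n. norm (R n w) \<le> 2 * B n"])
        (use R_bound in simp)
    then show ?thesis
      using tannerys_theorem[of R "\<lambda>_. 0" "at z within S" "\<lambda>n. 2 * B n"] R_lim False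
        summable_mult[OF B, of 2] by auto
  qed simp
  then have "((\<lambda>w. (1 / norm (w - z)) *\<^sub>R
      ((\<Sum>n. F n w) - ((\<Sum>n. F n z) + (\<Sum>n. F' n (w - z))))) \<longlongrightarrow> 0) (at z within S)"
    by (rule Lim_transform_eventually) (use neq R_sum in \<open>auto elim!: eventually_mono\<close>)
  then show ?thesis
    using bl unfolding has_derivative_within by blast
qed

section \<open>The flow of probability mass functions\<close>
lemma increasing_of_deriv_nonneg:
  fixes y y' :: "real \<Rightarrow> real"
  assumes "l \<le> r"
    and deriv: "\<And>s. s \<in> {l..r} \<Longrightarrow> (y has_real_derivative y' s) (at s within {l..r})"
    and nonneg: "\<And>s. s \<in> {l..r} \<Longrightarrow> y' s \<ge> 0"
  shows "y l \<le> y r"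
proof (rule DERIV_nonneg_imp_increasing_open[OF \<open>l \<le> r\<close>])
  show "\<exists>d. (y has_real_derivative d) (at s) \<and> d \<ge> 0" if "l < s" "s < r" for s
    using deriv[of s] nonneg[of s] that by (auto simp: at_within_Icc_at)
  show "continuous_on {l..r} y" using deriv by (rule DERIV_continuous_on)
qed

text \<open>
  A mean value inequality in which the derivative is compared with that of another function \<open>A\<close>: the rate
  \<open>\<alpha>\<close> of the flow below may be unbounded on compact intervals, but it is the derivative of an explicit
  function.
\<close>
lemma abs_diff_le_of_deriv_le:
  fixes y y' A A' :: "real \<Rightarrow> real"
  assumes y: "\<And>s. s \<in> {a..b} \<Longrightarrow> (y has_real_derivative y' s) (at s within {a..b})"
    and A: "\<And>s. s \<in> {a..b} \<Longrightarrow> (A has_real_derivative A' s) (at s within {a..b})"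
    and le: "\<And>s. s \<in> {a..b} \<Longrightarrow> \<bar>y' s\<bar> \<le> B * A' s"
    and s: "s \<in> {a..b}" and t: "t \<in> {a..b}"
  shows "\<bar>y s - y t\<bar> \<le> \<bar>B * (A s - A t)\<bar>"
proof -
  have main: "\<bar>y r - y l\<bar> \<le> B * (A r - A l)" if lr: "a \<le> l" "l \<le> r" "r \<le> b" for l r
  proof -
    have sub: "{l..r} \<subseteq> {a..b}" using lr by auto
    have D: "(y has_real_derivative y' s) (at s within {l..r})"
      "(A has_real_derivative A' s) (at s within {l..r})"
      and le': "0 \<le> B * A' s - y' s" "0 \<le> B * A' s + y' s" if "s \<in> {l..r}" for s
      using DERIV_subset[OF y sub, of s] DERIV_subset[OF A sub, of s] le[of s] sub that
      by (auto simp: abs_le_iff)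
    have "B * A l - y l \<le> B * A r - y r"
      by (rule increasing_of_deriv_nonneg[OF lr(2), of _ "\<lambda>s. B * A' s - y' s"])
        (use le' in \<open>auto intro!: derivative_eq_intros D\<close>)
    moreover have "B * A l + y l \<le> B * A r + y r"
      by (rule increasing_of_deriv_nonneg[OF lr(2), of _ "\<lambda>s. B * A' s + y' s"])
        (use le' in \<open>auto intro!: derivative_eq_intros D\<close>)
    ultimately show ?thesis by (simp add: abs_le_iff algebra_simps)
  qed
  show ?thesis
  proof (cases "s \<le> t")
    case True
    then show ?thesis using main[of s t] s t by (simp add: abs_minus_commute right_diff_distrib)
  next
    case False
    then show ?thesis using main[of t s] s t by simp
  qed
qed

lemma has_derivative_compose_fst:
  fixes u :: "real \<Rightarrow> real"
  assumes "(u has_real_derivative D) (at (fst z) within {0..})"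
  shows "((\<lambda>w. u (fst w)) has_derivative (\<lambda>w. D * fst w)) (at z within {0..T} \<times> UNIV)"
proof -
  have "(u has_derivative (*) D) (at (fst z) within fst ` ({0..T} \<times> (UNIV :: 'b set)))"
    using assms unfolding has_field_derivative_def by (rule has_derivative_subset) auto
  from has_derivative_in_compose[OF has_derivative_fst[OF has_derivative_ident] this]
  show ?thesis by simp
qed

lemma summable_shift_down: "summable u \<Longrightarrow> summable (shift_down u)"
  by (subst summable_Suc_iff[symmetric]) (simp add: shift_down_def)

lemma suminf_eq_suminf_Suc:
  fixes w :: "nat \<Rightarrow> real"
  assumes "summable w" "w 0 = 0"
  shows "(\<Sum>x. w x) = (\<Sum>x. w (Suc x))"
  using suminf_split_head[OF assms(1)] assms(2) by simp

lemma summable_pmf: "summable (pmf (U :: nat pmf))"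
  using integrable_pmf[of UNIV U] by (simp add: integrable_count_space_nat_iff)

lemma suminf_pmf: "(\<Sum>x. pmf (U :: nat pmf) x) = 1"
  using integral_pmf[of UNIV U] integrable_pmf[of UNIV U]
    integral_count_space_nat[of "pmf U"] by simp


text \<open>
  The equation says that, read backwards in time, independent Poisson variables are added to the
  random variable with law \<open>V t\<close>.
\<close>
locale poisson_flow =
  fixes V :: "real \<Rightarrow> nat pmf" and \<alpha> :: "real \<Rightarrow> real"
  assumes V_pos: "\<And>t x. t \<ge> 0 \<Longrightarrow> pmf (V t) x > 0"
    and \<alpha>_pos: "\<And>t. t \<ge> 0 \<Longrightarrow> \<alpha> t > 0"
    and V_deriv: "\<And>t x. t \<ge> 0 \<Longrightarrow>
          ((\<lambda>s. pmf (V s) x) has_real_derivative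
             \<alpha> t * (pmf (V t) x - shift_down (pmf (V t)) x)) (at t within {0..})"
begin

text \<open>
  At \<open>x = 0\<close> the equation reads \<open>V' = \<alpha> V\<close>, so this is an antiderivative of \<open>\<alpha>\<close>: the time scale on
  which the flow has unit rate.
\<close>
definition clock :: "real \<Rightarrow> real" where "clock t = ln (pmf (V t) 0)"

lemma clock_deriv:
  assumes "t \<ge> 0"
  shows "(clock has_real_derivative \<alpha> t) (at t within {0..})"
proof -
  have "((\<lambda>s. ln (pmf (V s) 0)) has_real_derivative
      1 / pmf (V t) 0 * (\<alpha> t * (pmf (V t) 0 - shift_down (pmf (V t)) 0))) (at t within {0..})"
    using V_pos[OF assms, of 0] by (intro DERIV_chain2[OF DERIV_ln_divide V_deriv[OF assms]]) auto
  then show ?thesis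
    using V_pos[OF assms, of 0] unfolding clock_def by (simp add: shift_down_def)
qed

lemma shift_down_nonneg: "shift_down (pmf U) x \<ge> 0"
  by (simp add: shift_down_def)

text \<open>
  A summable bound for all \<open>V t\<close> at once. It is available because \<open>V t x / V t 0\<close> decreases in \<open>t\<close>: its
  derivative is \<open>-\<alpha> V t (x - 1) / V t 0\<close>.
\<close>
definition envelope :: "nat \<Rightarrow> real" where "envelope x = pmf (V 0) x / pmf (V 0) 0"

lemma V_le_envelope:
  assumes t: "t \<ge> 0"
  shows "pmf (V t) x \<le> envelope x"
proof -
  have D: "((\<lambda>s. pmf (V s) y) has_real_derivative
             \<alpha> s * (pmf (V s) y - shift_down (pmf (V s)) y)) (at s within {0..t})"
    if "s \<in> {0..t}" for s y
    by (rule DERIV_subset[OF V_deriv]) (use that in auto)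
  have "- (pmf (V 0) x / pmf (V 0) 0) \<le> - (pmf (V t) x / pmf (V t) 0)"
  proof (rule increasing_of_deriv_nonneg[OF t, where
        y' = "\<lambda>s. \<alpha> s * shift_down (pmf (V s)) x / pmf (V s) 0"])
    fix s assume s: "s \<in> {0..t}"
    have pos: "pmf (V s) 0 > 0" using V_pos s by auto
    show "((\<lambda>s. - (pmf (V s) x / pmf (V s) 0)) has_real_derivative
        \<alpha> s * shift_down (pmf (V s)) x / pmf (V s) 0) (at s within {0..t})"
    proof (rule DERIV_cong[OF DERIV_minus[OF DERIV_divide[OF D[OF s, of x] D[OF s, of 0]]]])
      have "shift_down (pmf (V s)) 0 = 0" by (simp add: shift_down_def)
      then show "- ((\<alpha> s * (pmf (V s) x - shift_down (pmf (V s)) x) * pmf (V s) 0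
           - pmf (V s) x * (\<alpha> s * (pmf (V s) 0 - shift_down (pmf (V s)) 0)))
           / (pmf (V s) 0 * pmf (V s) 0)) = \<alpha> s * shift_down (pmf (V s)) x / pmf (V s) 0"
        using pos by (simp add: field_simps)
    qed (use pos in simp)
    show "0 \<le> \<alpha> s * shift_down (pmf (V s)) x / pmf (V s) 0"
      using pos \<alpha>_pos[of s] s by (auto simp: shift_down_nonneg)
  qed
  then have "pmf (V t) x \<le> envelope x * pmf (V t) 0"
    using V_pos[OF t, of 0] by (simp add: envelope_def field_simps)
  also have "\<dots> \<le> envelope x * 1"
    by (intro mult_left_mono pmf_le_1) (simp add: envelope_def)
  finally show ?thesis by simp
qed

lemma envelope_nonneg: "envelope x \<ge> 0"
  by (simp add: envelope_def)

lemma summable_envelope: "summable envelope"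
  unfolding envelope_def by (intro summable_divide summable_pmf)

lemma shift_down_V_le_envelope: "t \<ge> 0 \<Longrightarrow> shift_down (pmf (V t)) x \<le> shift_down envelope x"
  by (simp add: shift_down_def V_le_envelope)

end

text \<open>
  The equation for \<open>g\<close> expresses that \<open>V t x * g t x\<close> solves the same equation as \<open>V t x\<close>, so that \<open>g\<close> at
  an earlier time is a conditional expectation of \<open>g\<close> at a later time.
\<close>
locale conditioned_flow = poisson_flow +
  fixes g :: "real \<Rightarrow> nat \<Rightarrow> real"
  assumes g_deriv: "\<And>t x. t \<ge> 0 \<Longrightarrow>
          ((\<lambda>s. g s x) has_real_derivative
             \<alpha> t * (shift_down (pmf (V t)) x / pmf (V t) x) * (g t x - g t (x - 1)))
            (at t within {0..})"

section \<open>The inequality for bounded solutions\<close>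
locale bounded_flow = conditioned_flow +
  fixes T M :: real
  assumes T_nonneg: "T \<ge> 0"
    and g_bound: "\<And>t x. t \<in> {0..T} \<Longrightarrow> \<bar>g t x\<bar> \<le> M"
begin

definition summand :: "nat \<Rightarrow> real \<times> real \<Rightarrow> real" where
  "summand x z = pmf (V (fst z)) x * exp (snd z * g (fst z) x)"

definition summand_ds :: "real \<Rightarrow> real \<Rightarrow> nat \<Rightarrow> real" where
  "summand_ds s q x = \<alpha> s * ((pmf (V s) x - shift_down (pmf (V s)) x) * exp (q * g s x)
      + shift_down (pmf (V s)) x * q * (g s x - g s (x - 1)) * exp (q * g s x))"

definition summand_dq :: "real \<Rightarrow> real \<Rightarrow> nat \<Rightarrow> real" where
  "summand_dq s q x = pmf (V s) x * g s x * exp (q * g s x)"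

text \<open>
  The factor is large enough to serve both partial derivatives of a summand, for exponents of modulus at
  most \<open>r\<close>.
\<close>
definition bound_factor :: "real \<Rightarrow> real" where "bound_factor r = exp (r * M) * (1 + M + 2 * r * M)"

definition bound :: "real \<Rightarrow> nat \<Rightarrow> real" where "bound r x = bound_factor r * (envelope x + shift_down envelope x)"

lemma M_nonneg: "M \<ge> 0"
  using g_bound[of 0 0] T_nonneg by auto

lemma exp_bound:
  assumes "s \<in> {0..T}" "\<bar>q\<bar> \<le> r"
  shows "exp (q * g s x) \<le> exp (r * M)" "exp (- (r * M)) \<le> exp (q * g s x)"
proof -
  have "\<bar>q * g s x\<bar> \<le> r * M"
    unfolding abs_mult using assms g_bound[of s x] by (intro mult_mono) auto
  then show "exp (q * g s x) \<le> exp (r * M)" "exp (- (r * M)) \<le> exp (q * g s x)" by auto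
qed

lemma bound_nonneg: "r \<ge> 0 \<Longrightarrow> bound r x \<ge> 0"
  using M_nonneg envelope_nonneg unfolding bound_def bound_factor_def
  by (intro mult_nonneg_nonneg add_nonneg_nonneg) (auto simp: shift_down_def)

lemma summable_bound: "summable (bound r)"
  unfolding bound_def by (intro summable_mult summable_add summable_envelope summable_shift_down)

lemma summand_ds_le:
  assumes s: "s \<in> {0..T}" and q: "\<bar>q\<bar> \<le> r"
  shows "\<bar>summand_ds s q x\<bar> \<le> bound r x * \<alpha> s"
proof -
  define v where "v = pmf (V s) x"
  define w where "w = shift_down (pmf (V s)) x"
  define e where "e = exp (q * g s x)"
  define d where "d = g s x - g s (x - 1)"
  have v: "0 \<le> v" "v \<le> envelope x" using V_le_envelope[of s x] s by (auto simp: v_def)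
  have w: "0 \<le> w" "w \<le> shift_down envelope x"
    using shift_down_V_le_envelope[of s x] shift_down_nonneg s by (auto simp: w_def)
  have e: "0 \<le> e" "e \<le> exp (r * M)" using exp_bound[OF s q] by (auto simp: e_def)
  have d: "\<bar>d\<bar> \<le> 2 * M" using g_bound[OF s, of x] g_bound[OF s, of "x - 1"] by (simp add: d_def)
  have r: "r \<ge> 0" using q by linarith
  have "\<bar>q * d\<bar> \<le> r * (2 * M)"
    unfolding abs_mult using q d r by (intro mult_mono) auto
  then have "w * \<bar>q * d\<bar> \<le> w * (r * (2 * M))"
    using w by (intro mult_left_mono) auto
  then have "\<bar>w * (q * d)\<bar> \<le> w * (2 * r * M)"
    using w by (simp add: abs_mult mult_ac)
  then have "\<bar>v - w + w * (q * d)\<bar> \<le> v + w + w * (2 * r * M)"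
    using v w by linarith
  also have "\<dots> \<le> (v + w) * (1 + M + 2 * r * M)"
    using v w r M_nonneg by (simp add: algebra_simps)
  also have "\<dots> \<le> (envelope x + shift_down envelope x) * (1 + M + 2 * r * M)"
    using v w r M_nonneg by (intro mult_right_mono) auto
  finally have "\<bar>(v - w + w * (q * d)) * e\<bar>
      \<le> (envelope x + shift_down envelope x) * (1 + M + 2 * r * M) * exp (r * M)"
    unfolding abs_mult using e v w r M_nonneg by (intro mult_mono) auto
  then have "\<bar>(v - w + w * (q * d)) * e\<bar> \<le> bound r x" by (simp add: bound_def bound_factor_def mult_ac)
  moreover have "summand_ds s q x = \<alpha> s * ((v - w + w * (q * d)) * e)"
    unfolding summand_ds_def v_def w_def d_def e_def by (simp add: algebra_simps)
  ultimately show ?thesis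
    using \<alpha>_pos[of s] s by (simp add: abs_mult mult.commute)
qed

lemma summand_dq_le:
  assumes s: "s \<in> {0..T}" and q: "\<bar>q\<bar> \<le> r"
  shows "\<bar>summand_dq s q x\<bar> \<le> bound r x"
proof -
  have r: "r \<ge> 0" using q by linarith
  have "\<bar>summand_dq s q x\<bar> \<le> envelope x * M * exp (r * M)"
    unfolding summand_dq_def abs_mult
    using s V_le_envelope[of s x] g_bound[OF s, of x] exp_bound[OF s q, of x] M_nonneg envelope_nonneg
    by (intro mult_mono) auto
  also have "\<dots> \<le> (envelope x + shift_down envelope x) * (1 + M + 2 * r * M) * exp (r * M)"
    using envelope_nonneg M_nonneg r by (intro mult_mono) (auto simp: shift_down_def)
  finally show ?thesis by (simp add: bound_def bound_factor_def mult_ac)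
qed

lemma summand_le:
  assumes s: "s \<in> {0..T}" and q: "\<bar>q\<bar> \<le> r"
  shows "\<bar>summand x (s, q)\<bar> \<le> exp (r * M) * envelope x"
  unfolding summand_def abs_mult
  using s V_le_envelope[of s x] exp_bound[OF s q, of x] envelope_nonneg
  by (subst mult.commute) (auto intro!: mult_mono)

lemma summable_summand:
  assumes "s \<in> {0..T}"
  shows "summable (\<lambda>x. summand x (s, q))"
  by (rule summable_comparison_test'[OF summable_mult[OF summable_envelope, of "exp (\<bar>q\<bar> * M)"], of 0])
    (use summand_le[OF assms, of q "\<bar>q\<bar>"] in auto)

lemma summable_summand_ds:
  assumes "s \<in> {0..T}"
  shows "summable (summand_ds s q)"
  by (rule summable_comparison_test'[OF summable_mult2[OF summable_bound[of "\<bar>q\<bar>"], of "\<alpha> s"], of 0])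
    (use summand_ds_le[OF assms, of q "\<bar>q\<bar>"] in auto)

lemma summable_summand_dq:
  assumes "s \<in> {0..T}"
  shows "summable (summand_dq s q)"
  by (rule summable_comparison_test'[OF summable_bound[of "\<bar>q\<bar>"], of 0])
    (use summand_dq_le[OF assms, of q "\<bar>q\<bar>"] in auto)

lemma summand_has_ds:
  assumes s: "s \<ge> 0"
  shows "((\<lambda>s. summand x (s, q)) has_real_derivative summand_ds s q x) (at s within {0..})"
  unfolding summand_def fst_conv snd_conv
  by (rule derivative_eq_intros V_deriv[OF s] g_deriv[OF s] refl)+
    (use V_pos[OF s, of x] in \<open>auto simp: summand_ds_def field_simps\<close>)

lemma summand_has_dq:
  "((\<lambda>q. summand x (s, q)) has_real_derivative summand_dq s q x) (at q within S)"
  unfolding summand_def fst_conv snd_conv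
  by (rule derivative_eq_intros refl)+ (auto simp: summand_dq_def)

lemma summand_has_derivative:
  assumes s: "s \<ge> 0"
  shows "(summand x has_derivative (\<lambda>z. summand_ds s q x * fst z + summand_dq s q x * snd z))
     (at (s, q) within {0..T} \<times> UNIV)"
proof -
  have V: "((\<lambda>w. pmf (V (fst w)) x) has_derivative
      (\<lambda>w. \<alpha> s * (pmf (V s) x - shift_down (pmf (V s)) x) * fst w)) (at (s, q) within {0..T} \<times> UNIV)"
    using V_deriv[OF s, of x] by (intro has_derivative_compose_fst) simp
  have g: "((\<lambda>w. g (fst w) x) has_derivative
      (\<lambda>w. \<alpha> s * (shift_down (pmf (V s)) x / pmf (V s) x) * (g s x - g s (x - 1)) * fst w))
       (at (s, q) within {0..T} \<times> UNIV)"
    using g_deriv[OF s, of x] by (intro has_derivative_compose_fst) simp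
  show ?thesis
    unfolding summand_def
    by (rule derivative_eq_intros V g refl)+
      (use V_pos[OF s, of x] in \<open>auto simp: summand_ds_def summand_dq_def field_simps fun_eq_iff\<close>)
qed

text \<open>
  The time increment is measured by the clock, which makes the constant independent of \<open>\<alpha>\<close> and thus
  summable over \<open>x\<close> uniformly in time.
\<close>
lemma summand_lipschitz:
  assumes s: "s \<in> {0..T}" "t \<in> {0..T}" and q: "\<bar>q\<bar> \<le> r" "\<bar>q'\<bar> \<le> r"
  shows "\<bar>summand x (s, q) - summand x (t, q')\<bar> \<le> bound r x * (\<bar>clock s - clock t\<bar> + \<bar>q - q'\<bar>)"
proof -
  have r: "r \<ge> 0" using q by linarith
  have "\<bar>summand x (s, q) - summand x (t, q)\<bar> \<le> \<bar>bound r x * (clock s - clock t)\<bar>"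
    by (rule abs_diff_le_of_deriv_le[OF DERIV_subset[OF summand_has_ds] DERIV_subset[OF clock_deriv]
          summand_ds_le[OF _ q(1)] s]) auto
  moreover have "\<bar>summand x (t, q) - summand x (t, q')\<bar> \<le> \<bar>bound r x * (q - q')\<bar>"
    by (rule abs_diff_le_of_deriv_le[OF summand_has_dq DERIV_ident, of "-r" r])
      (use summand_dq_le[OF s(2)] q in auto)
  ultimately show ?thesis using bound_nonneg[OF r, of x] unfolding abs_mult distrib_left by simp
qed

lemma series_has_derivative:
  assumes s: "s \<in> {0..T}"
  shows "((\<lambda>z. \<Sum>x. summand x z) has_derivative
       (\<lambda>z. (\<Sum>x. summand_ds s q x) * fst z + (\<Sum>x. summand_dq s q x) * snd z))
     (at (s, q) within {0..T} \<times> UNIV)"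
proof -
  define r where "r = \<bar>q\<bar> + 1"
  define B where "B x = bound r x * (\<alpha> s + 2)" for x
  have s0: "s \<ge> 0" and r: "\<bar>q\<bar> \<le> r" "r \<ge> 0" using s by (auto simp: r_def)
  have \<alpha>: "\<alpha> s > 0" using \<alpha>_pos[OF s0] .
  let ?F = "at (s, q) within {0..T} \<times> (UNIV :: real set)"
  have "((\<lambda>w. clock (fst w)) has_derivative (\<lambda>w. \<alpha> s * fst w)) ?F"
    using clock_deriv[OF s0] by (intro has_derivative_compose_fst) simp
  then have "\<forall>e>0. \<forall>\<^sub>F w in ?F. norm (clock (fst w) - clock (fst (s, q)) - \<alpha> s * fst (w - (s, q)))
      \<le> e * norm (w - (s, q))"
    unfolding has_derivative_within_alt2 by (rule conjunct2)
  from this[rule_format, of 1] have clock_ev: "\<forall>\<^sub>F w in ?F.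
      norm (clock (fst w) - clock s - \<alpha> s * fst (w - (s, q))) \<le> 1 * norm (w - (s, q))"
    by (simp only: fst_conv zero_less_one)
  have r_ev: "\<forall>\<^sub>F w in ?F. w \<in> {0..T} \<times> UNIV \<and> norm (w - (s, q)) < 1"
    unfolding eventually_at by (intro exI[of _ 1]) (auto simp: dist_norm)
  \<comment> \<open>Near \<open>s\<close> the clock is Lipschitz with constant \<open>\<alpha> s + 1\<close>; one more unit pays for the exponent.\<close>
  have lip: "\<forall>\<^sub>F w in ?F. \<forall>x. \<bar>summand x w - summand x (s, q)\<bar> \<le> B x * norm (w - (s, q))"
    using eventually_conj[OF clock_ev r_ev]
  proof (rule eventually_mono, intro allI)
    fix w :: "real \<times> real" and x
    assume w: "norm (clock (fst w) - clock s - \<alpha> s * fst (w - (s, q))) \<le> 1 * norm (w - (s, q)) \<and>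
        w \<in> {0..T} \<times> UNIV \<and> norm (w - (s, q)) < 1"
    obtain t q' where tq: "w = (t, q')" by (cases w)
    let ?n = "norm (w - (s, q))"
    have ts: "\<bar>t - s\<bar> \<le> ?n" "\<bar>q' - q\<bar> \<le> ?n"
      using norm_fst_le[of "t - s" "q' - q"] norm_snd_le[of "q' - q" "t - s"] by (auto simp: tq)
    then have q': "\<bar>q'\<bar> \<le> r" using w by (auto simp: r_def)
    have "\<bar>\<alpha> s * (t - s)\<bar> \<le> \<alpha> s * ?n"
      unfolding abs_mult using ts \<alpha> by simp
    moreover have "\<bar>clock t - clock s - \<alpha> s * (t - s)\<bar> \<le> ?n" using w by (simp add: tq)
    ultimately have "\<bar>clock t - clock s\<bar> + \<bar>q' - q\<bar> \<le> \<alpha> s * ?n + 2 * ?n"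
      using ts(2) by linarith
    then have "\<bar>clock t - clock s\<bar> + \<bar>q' - q\<bar> \<le> (\<alpha> s + 2) * ?n"
      by (simp add: distrib_right)
    then have "bound r x * (\<bar>clock t - clock s\<bar> + \<bar>q' - q\<bar>) \<le> bound r x * ((\<alpha> s + 2) * ?n)"
      using bound_nonneg[OF r(2)] by (rule mult_left_mono)
    then show "\<bar>summand x w - summand x (s, q)\<bar> \<le> B x * ?n"
      using summand_lipschitz[of t s q' r q x] s w q' r unfolding B_def tq by (simp add: mult.assoc)
  qed
  have "((\<lambda>z. \<Sum>x. summand x z) has_derivative
       (\<lambda>z. \<Sum>x. summand_ds s q x * fst z + summand_dq s q x * snd z)) ?F"
  proof (rule has_derivative_suminf_dominated[OF summand_has_derivative[OF s0] lip])
    fix x and h :: "real \<times> real"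
    have "\<bar>summand_ds s q x * fst h\<bar> \<le> bound r x * \<alpha> s * norm h"
      unfolding abs_mult using summand_ds_le[OF s r(1), of x] norm_fst_le[of "fst h" "snd h"]
        bound_nonneg[OF r(2), of x] \<alpha> by (intro mult_mono) auto
    moreover have "\<bar>summand_dq s q x * snd h\<bar> \<le> bound r x * norm h"
      unfolding abs_mult using summand_dq_le[OF s r(1), of x] norm_snd_le[of "snd h" "fst h"]
        bound_nonneg[OF r(2), of x] by (intro mult_mono) auto
    moreover have "bound r x * norm h \<ge> 0" using bound_nonneg[OF r(2)] by simp
    ultimately show "\<bar>summand_ds s q x * fst h + summand_dq s q x * snd h\<bar> \<le> B x * norm h"
      unfolding B_def by (simp add: algebra_simps)
  next
    show "summable B" unfolding B_def by (intro summable_mult2 summable_bound)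
    show "summable (\<lambda>x. summand x z)" if "z \<in> {0..T} \<times> UNIV" for z
      using that summable_summand[of "fst z" "snd z"] by auto
    show "summable (\<lambda>x. summand x (s, q))" by (rule summable_summand[OF s])
  qed
  moreover have "(\<Sum>x. summand_ds s q x * a + summand_dq s q x * b)
      = (\<Sum>x. summand_ds s q x) * a + (\<Sum>x. summand_dq s q x) * b" for a b
    by (simp add: suminf_add[symmetric] suminf_mult2[symmetric] summable_mult2
        summable_summand_ds[OF s] summable_summand_dq[OF s])
  ultimately show ?thesis by simp
qed

end

context bounded_flow
begin

text \<open>
  The moment generating function of \<open>g s\<close> under \<open>V s\<close>, as a function of time and exponent.
\<close>
definition mgf :: "real \<times> real \<Rightarrow> real" where "mgf z = (\<Sum>x. summand x z)"

lemma mgf_bounds: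
  assumes s: "s \<in> {0..T}" and q: "q \<ge> 0"
  shows "exp (- (q * M)) \<le> mgf (s, q)" "mgf (s, q) \<le> exp (q * M)"
proof -
  have le: "pmf (V s) x * exp (- (q * M)) \<le> summand x (s, q)"
    "summand x (s, q) \<le> pmf (V s) x * exp (q * M)" for x
    unfolding summand_def fst_conv snd_conv
    using exp_bound[OF s, of q q x] q by (intro mult_left_mono; simp)+
  have "exp (- (q * M)) = (\<Sum>x. pmf (V s) x * exp (- (q * M)))"
    by (simp add: suminf_mult2[OF summable_pmf, symmetric] suminf_pmf)
  also have "\<dots> \<le> mgf (s, q)"
    unfolding mgf_def
    by (intro suminf_le summable_mult2 summable_pmf summable_summand[OF s] le)
  finally show "exp (- (q * M)) \<le> mgf (s, q)" .
  have "mgf (s, q) \<le> (\<Sum>x. pmf (V s) x * exp (q * M))"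
    unfolding mgf_def
    by (intro suminf_le summable_mult2 summable_pmf summable_summand[OF s] le)
  also have "\<dots> = exp (q * M)"
    by (simp add: suminf_mult2[OF summable_pmf, symmetric] suminf_pmf)
  finally show "mgf (s, q) \<le> exp (q * M)" .
qed

lemma mgf_pos: "s \<in> {0..T} \<Longrightarrow> q \<ge> 0 \<Longrightarrow> mgf (s, q) > 0"
  using mgf_bounds(1)[of s q] exp_gt_zero[of "- (q * M)"] by linarith

lemma abs_ln_mgf_le:
  assumes s: "s \<in> {0..T}" and q: "q \<ge> 0"
  shows "\<bar>ln (mgf (s, q))\<bar> \<le> q * M"
proof -
  have "ln (exp (- (q * M))) \<le> ln (mgf (s, q))" "ln (mgf (s, q)) \<le> ln (exp (q * M))"
    using mgf_bounds[OF s q] mgf_pos[OF s q] by (simp_all only: ln_le_cancel_iff exp_gt_zero)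
  then show ?thesis by (simp add: abs_le_iff)
qed

lemma abs_suminf_dq_le:
  assumes s: "s \<in> {0..T}" and q: "q \<ge> 0"
  shows "\<bar>\<Sum>x. summand_dq s q x\<bar> \<le> M * exp (q * M)"
proof -
  have "norm (\<Sum>x. summand_dq s q x) \<le> (\<Sum>x. pmf (V s) x * (M * exp (q * M)))"
  proof (rule norm_suminf_le)
    show "summable (\<lambda>x. pmf (V s) x * (M * exp (q * M)))"
      by (intro summable_mult2 summable_pmf)
    show "norm (summand_dq s q x) \<le> pmf (V s) x * (M * exp (q * M))" for x
      unfolding summand_dq_def real_norm_def abs_mult mult.assoc
      using g_bound[OF s, of x] exp_bound[OF s, of q q x] q M_nonneg
      by (intro mult_mono) auto
  qed
  then show ?thesis by (simp add: suminf_mult2[OF summable_pmf, symmetric] suminf_pmf)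
qed

definition dissipation :: "real \<Rightarrow> real \<Rightarrow> nat \<Rightarrow> real" where
  "dissipation s q x = pmf (V s) x * exp (q * g s (x + 1)) *
     (ln (exp (q * g s (x + 1)) / exp (q * g s x)) - 1
       + exp (q * g s x) / exp (q * g s (x + 1)))"

text \<open>
  The contribution of \<open>V s (x - 1)\<close> to the derivative at \<open>x\<close> is attributed to \<open>x - 1\<close> instead; this summation by parts
  turns backward into forward differences of \<open>g\<close>.
\<close>
lemma
  assumes s: "s \<in> {0..T}"
  shows summable_dissipation: "summable (dissipation s q)"
    and suminf_ds: "(\<Sum>x. summand_ds s q x) = \<alpha> s * (\<Sum>x. dissipation s q x)"
proof -
  have \<alpha>: "\<alpha> s > 0" using \<alpha>_pos[of s] s by auto
  define w where "w x = summand x (s, q) - summand_ds s q x / \<alpha> s" for x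
  have sw: "summable w"
    unfolding w_def by (intro summable_diff summable_divide summable_summand summable_summand_ds s)
  have w: "w x = shift_down (pmf (V s)) x * exp (q * g s x) * (1 - q * (g s x - g s (x - 1)))" for x
  proof -
    have "summand_ds s q x / \<alpha> s = (pmf (V s) x - shift_down (pmf (V s)) x) * exp (q * g s x)
        + shift_down (pmf (V s)) x * q * (g s x - g s (x - 1)) * exp (q * g s x)"
      using \<alpha> by (simp only: summand_ds_def) simp
    then show ?thesis by (simp add: w_def summand_def algebra_simps)
  qed
  have w0: "w 0 = 0" by (simp add: w shift_down_def)
  have sw1: "summable (\<lambda>x. w (Suc x))" using sw by (subst summable_Suc_iff)
  have diss: "dissipation s q x = summand x (s, q) - w (Suc x)" for x
    unfolding dissipation_def w summand_def
    by (simp add: ln_div shift_down_def algebra_simps)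
  show "summable (dissipation s q)"
    unfolding diss by (intro summable_diff summable_summand s sw1)
  have "(\<Sum>x. summand_ds s q x) = (\<Sum>x. \<alpha> s * (summand x (s, q) - w x))"
    using \<alpha> by (simp add: w_def)
  also have "\<dots> = \<alpha> s * ((\<Sum>x. summand x (s, q)) - (\<Sum>x. w x))"
    by (simp add: suminf_mult suminf_diff summable_diff summable_summand[OF s] sw)
  also have "(\<Sum>x. w x) = (\<Sum>x. w (Suc x))" by (rule suminf_eq_suminf_Suc[OF sw w0])
  also have "(\<Sum>x. summand x (s, q)) - (\<Sum>x. w (Suc x)) = (\<Sum>x. dissipation s q x)"
    by (simp add: diss suminf_diff summable_summand[OF s] sw1)
  finally show "(\<Sum>x. summand_ds s q x) = \<alpha> s * (\<Sum>x. dissipation s q x)" .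
qed

text \<open>
  For bounded \<open>g\<close> all series converge absolutely, and the inequality between extended reals becomes one
  between real numbers.
\<close>
lemma entropy_le_dissipation:
  fixes c :: real
  assumes s: "s \<in> {0..T}"
    and log_sobolev: "\<And>f :: nat \<Rightarrow> real.
          (\<And>x. f x > 0) \<Longrightarrow> summable (\<lambda>x. pmf (V s) x * f x) \<Longrightarrow>
          pmf_Ent (V s) f \<le> ereal (1 / c) *
            (\<Sum>x. ereal (pmf (V s) x * f (x + 1) *
               (ln (f (x + 1) / f x) - 1 + f x / f (x + 1))))"
  shows "q * (\<Sum>x. summand_dq s q x) - mgf (s, q) * ln (mgf (s, q))
     \<le> 1 / c * (\<Sum>x. dissipation s q x)"
proof -
  have "pmf_Ent (V s) (\<lambda>x. exp (q * g s x)) \<le> ereal (1 / c) * (\<Sum>x. ereal (dissipation s q x))"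
    unfolding dissipation_def
    by (rule log_sobolev) (use summable_summand[OF s, of q] in \<open>auto simp: summand_def\<close>)
  also have "(\<Sum>x. ereal (dissipation s q x)) = ereal (\<Sum>x. dissipation s q x)"
    by (rule suminf_ereal'[OF summable_dissipation[OF s]])
  finally have 1: "pmf_Ent (V s) (\<lambda>x. exp (q * g s x)) \<le> ereal (1 / c * (\<Sum>x. dissipation s q x))"
    by simp
  have "(\<Sum>x. ereal (pmf (V s) x * exp (q * g s x) * ln (exp (q * g s x))))
      = (\<Sum>x. ereal (q * summand_dq s q x))"
    by (simp add: summand_dq_def mult_ac)
  also have "\<dots> = ereal (q * (\<Sum>x. summand_dq s q x))"
    by (simp add: suminf_ereal'[OF summable_mult[OF summable_summand_dq[OF s]]]
        suminf_mult[OF summable_summand_dq[OF s]])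
  finally have "pmf_Ent (V s) (\<lambda>x. exp (q * g s x))
      = ereal (q * (\<Sum>x. summand_dq s q x) - mgf (s, q) * ln (mgf (s, q)))"
    by (simp add: pmf_Ent_def pmf_mean_def mgf_def summand_def)
  with 1 show ?thesis by simp
qed

text \<open>
  The function to which \<open>le_along_indefinite_integral\<close> applies is \<open>(1/q) ln F\<close> with \<open>q = p exp (-u)\<close>. Its
  partial derivatives in time and in \<open>u\<close> are \<open>\<alpha> D / (q F)\<close> and \<open>- Ent / (q F)\<close>.
\<close>
lemma exponential_moment_le_if_bounded:
  fixes c :: "real \<Rightarrow> real" and p :: real
  defines "q \<equiv> p * exp (- integral {0..T} (\<lambda>s. \<alpha> s * c s))"
  assumes p: "p > 0"
    and c_pos: "\<And>t. t \<in> {0..T} \<Longrightarrow> c t > 0"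
    and log_sobolev: "\<And>t (f :: nat \<Rightarrow> real).
          t \<in> {0..T} \<Longrightarrow> (\<And>x. f x > 0) \<Longrightarrow> summable (\<lambda>x. pmf (V t) x * f x) \<Longrightarrow>
          pmf_Ent (V t) f \<le> ereal (1 / c t) *
            (\<Sum>x. ereal (pmf (V t) x * f (x + 1) *
               (ln (f (x + 1) / f x) - 1 + f x / f (x + 1))))"
    and integrable: "(\<lambda>s. \<alpha> s * c s) integrable_on {0..T}"
  shows "(\<Sum>x. pmf (V 0) x * exp (p * g 0 x)) \<le> (\<Sum>x. pmf (V T) x * exp (q * g T x)) powr (p / q)"
proof -
  define k where "k s = \<alpha> s * c s" for s
  define r where "r s = p * exp (- integral {0..s} k)" for s
  define \<Theta> where "\<Theta> z = ln (mgf (fst z, p * exp (- snd z))) * (exp (snd z) / p)" for z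
  define P where "P s = (\<Sum>x. summand_ds s (r s) x) / (mgf (s, r s) * r s)" for s
  define Q where "Q s = - ((\<Sum>x. summand_dq s (r s) x) / mgf (s, r s)) + ln (mgf (s, r s)) / r s" for s
  have k_pos: "k s > 0" if "s \<in> {0..T}" for s
    using \<alpha>_pos[of s] c_pos[OF that] that by (simp add: k_def)
  have k_int: "k integrable_on {0..T}" using integrable by (simp add: k_def[abs_def])
  have r_pos: "r s > 0" for s using p by (simp add: r_def)
  have r_le: "r s \<le> p" if "s \<in> {0..T}" for s
  proof -
    have "k integrable_on {0..s}"
      using integrable_on_subinterval[OF k_int, of 0 s] that by auto
    then have "integral {0..s} k \<ge> 0"
      using k_pos that
      by (intro Henstock_Kurzweil_Integration.integral_nonneg) (auto intro!: less_imp_le)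
    then show ?thesis using p by (simp add: r_def)
  qed
  have "\<Theta> (0, 0) \<le> \<Theta> (T, integral {0..T} k)"
  proof (rule le_along_indefinite_integral[OF T_nonneg k_int])
    fix s assume s: "s \<in> {0..T}"
    note pos = mgf_pos[OF s less_imp_le[OF r_pos[of s]]] r_pos[of s]
    show "k s \<ge> 0" using k_pos[OF s] by simp
    let ?z = "(s, integral {0..s} k)" and ?D = "{0..T} \<times> (UNIV :: real set)"
    have "((\<lambda>z. (fst z, p * exp (- snd z))) has_derivative
        (\<lambda>w. (fst w, - r s * snd w))) (at ?z within ?D)"
      by (rule derivative_eq_intros refl)+ (auto simp: r_def)
    moreover have "(mgf has_derivative (\<lambda>z. (\<Sum>x. summand_ds s (r s) x) * fst z
        + (\<Sum>x. summand_dq s (r s) x) * snd z))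
        (at (fst ?z, p * exp (- snd ?z)) within (\<lambda>z. (fst z, p * exp (- snd z))) ` ?D)"
      using series_has_derivative[OF s, of "r s"]
      unfolding mgf_def[symmetric, abs_def] fst_conv snd_conv r_def
      by (rule has_derivative_subset) auto
    ultimately have mgf: "((\<lambda>z. mgf (fst z, p * exp (- snd z))) has_derivative
        (\<lambda>w. (\<Sum>x. summand_ds s (r s) x) * fst w + (\<Sum>x. summand_dq s (r s) x) * (- r s * snd w)))
        (at ?z within ?D)"
      by (drule_tac has_derivative_in_compose) auto
    have exp: "((\<lambda>z. exp (snd z) / p) has_derivative (\<lambda>w. 1 / r s * snd w)) (at ?z within ?D)"
      by (rule derivative_eq_intros refl)+ (use p in \<open>auto simp: r_def exp_minus field_simps\<close>)
    have r_inv: "exp (integral {0..s} k) / p = 1 / r s"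
      by (simp add: r_def exp_minus field_simps)
    have "(\<Theta> has_derivative (\<lambda>w. ln (mgf (s, r s)) * (1 / r s * snd w)
        + ((\<Sum>x. summand_ds s (r s) x) * fst w
            + (\<Sum>x. summand_dq s (r s) x) * (- r s * snd w)) * (1 / mgf (s, r s)) * (1 / r s))) (at ?z within ?D)"
      using has_derivative_mult[OF has_derivative_ln[OF _ mgf] exp] pos
      unfolding \<Theta>_def[abs_def] fst_conv snd_conv r_inv by (simp add: r_def divide_inverse)
    then show "(\<Theta> has_derivative (\<lambda>z. P s * fst z + Q s * snd z)) (at ?z within ?D)"
      by (rule has_derivative_eq_rhs)
        (use pos in \<open>auto simp: P_def Q_def fun_eq_iff field_simps\<close>)
    show "\<bar>Q s\<bar> \<le> M * exp (p * M) / exp (- (p * M)) + M"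
    proof -
      have rM: "r s * M \<le> p * M" using r_le[OF s] M_nonneg by (rule mult_right_mono)
      have "\<bar>\<Sum>x. summand_dq s (r s) x\<bar> / mgf (s, r s) \<le> M * exp (p * M) / exp (- (p * M))"
      proof (intro frac_le)
        show "\<bar>\<Sum>x. summand_dq s (r s) x\<bar> \<le> M * exp (p * M)"
          using abs_suminf_dq_le[OF s, of "r s"] pos rM M_nonneg
            mult_left_mono[of "exp (r s * M)" "exp (p * M)" M] by auto
        show "exp (- (p * M)) \<le> mgf (s, r s)"
          using mgf_bounds(1)[OF s, of "r s"] pos rM order_trans[of "exp (- (p * M))" "exp (- (r s * M))"]
          by auto
      qed (use M_nonneg in auto)
      moreover have "\<bar>ln (mgf (s, r s))\<bar> / r s \<le> M"
        using abs_ln_mgf_le[OF s, of "r s"] pos by (simp add: divide_le_eq mult.commute)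
      moreover have "\<bar>Q s\<bar> \<le> \<bar>\<Sum>x. summand_dq s (r s) x\<bar> / mgf (s, r s) + \<bar>ln (mgf (s, r s))\<bar> / r s"
        unfolding Q_def using pos by (intro order_trans[OF abs_triangle_ineq]) auto
      ultimately show ?thesis by linarith
    qed
    show "P s + k s * Q s \<ge> 0"
    proof -
      define E where "E = r s * (\<Sum>x. summand_dq s (r s) x) - mgf (s, r s) * ln (mgf (s, r s))"
      define D where "D = (\<Sum>x. dissipation s (r s) x)"
      have c: "c s > 0" using c_pos[OF s] .
      have "E \<le> 1 / c s * D"
        unfolding E_def D_def by (rule entropy_le_dissipation[OF s log_sobolev[OF s]])
      then have "c s * E \<le> D" using c by (simp add: field_simps)
      then have "\<alpha> s * (D - c s * E) \<ge> 0"
        using \<alpha>_pos[of s] s by (intro mult_nonneg_nonneg) auto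
      moreover have "P s + k s * Q s = \<alpha> s * (D - c s * E) / (mgf (s, r s) * r s)"
        unfolding P_def Q_def k_def E_def suminf_ds[OF s] D_def using pos
        by (simp add: field_simps)
      ultimately show ?thesis using pos by simp
    qed
  qed
  then have "ln (mgf (0, p)) / p \<le> ln (mgf (T, q)) / q"
    by (simp add: \<Theta>_def q_def k_def[abs_def] exp_minus field_simps)
  then have "ln (mgf (0, p)) \<le> p / q * ln (mgf (T, q))"
    using p by (simp add: field_simps)
  then have "exp (ln (mgf (0, p))) \<le> exp (p / q * ln (mgf (T, q)))"
    by (simp only: exp_le_cancel_iff)
  moreover have "q > 0" using p by (simp add: q_def)
  ultimately have "mgf (0, p) \<le> mgf (T, q) powr (p / q)"
    using mgf_pos[of 0 p] mgf_pos[of T q] p T_nonneg by (simp add: powr_def)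
  then show ?thesis by (simp add: mgf_def summand_def)
qed

end

section \<open>Poisson convolution and truncation\<close>
text \<open>
  Convolution with the Poisson weights \<open>l ^ j / j!\<close>, without the normalisation \<open>exp (- l)\<close>. Leaving it out
  makes differentiation in \<open>l\<close> a plain shift and allows negative \<open>l\<close>.
\<close>
definition exp_conv :: "real \<Rightarrow> (nat \<Rightarrow> real) \<Rightarrow> nat \<Rightarrow> real" where
  "exp_conv l H x = (\<Sum>j\<le>x. H (x - j) * (l ^ j / fact j))"

lemma exp_conv_has_derivative:
  "((\<lambda>l. exp_conv l H x) has_real_derivative shift_down (exp_conv l H) x) (at l within S)"
proof -
  define d where "d j = (if j = 0 then 0 else l ^ (j - 1) / fact (j - 1))" for j :: nat
  have "((\<lambda>l. l ^ j / fact j) has_real_derivative d j) (at l within S)" for j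
    by (rule DERIV_cong[OF DERIV_cdivide[OF DERIV_pow]])
      (cases j, auto simp: d_def fact_Suc simp del: of_nat_Suc)
  then have "((\<lambda>l. exp_conv l H x) has_real_derivative (\<Sum>j\<le>x. H (x - j) * d j)) (at l within S)"
    unfolding exp_conv_def by (intro DERIV_sum DERIV_cmult)
  moreover have "(\<Sum>j\<le>x. H (x - j) * d j) = shift_down (exp_conv l H) x"
    by (cases x) (auto simp: d_def shift_down_def exp_conv_def sum.atMost_Suc_shift
        simp del: sum.atMost_Suc)
  ultimately show ?thesis by simp
qed

lemma exp_conv_0: "exp_conv 0 H x = H x"
proof -
  have "exp_conv 0 H x = (\<Sum>j\<le>x. if j = 0 then H x else 0)"
    unfolding exp_conv_def by (intro sum.cong) auto
  then show ?thesis by simp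
qed

lemma exp_conv_cong: "(\<And>y. y \<le> x \<Longrightarrow> H y = H' y) \<Longrightarrow> exp_conv l H x = exp_conv l H' x"
  unfolding exp_conv_def by (intro sum.cong) auto

lemma abs_exp_conv_mult_le:
  assumes "l \<ge> 0" "\<And>y. H y \<ge> 0" "\<And>y. \<bar>G y\<bar> \<le> M"
  shows "\<bar>exp_conv l (\<lambda>y. H y * G y) x\<bar> \<le> M * exp_conv l H x"
proof -
  have "\<bar>exp_conv l (\<lambda>y. H y * G y) x\<bar> \<le> (\<Sum>j\<le>x. M * (H (x - j) * (l ^ j / fact j)))"
    unfolding exp_conv_def
  proof (rule order_trans[OF sum_abs sum_mono])
    fix j
    have "\<bar>G (x - j)\<bar> * (H (x - j) * (l ^ j / fact j)) \<le> M * (H (x - j) * (l ^ j / fact j))"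
      using assms by (intro mult_right_mono) auto
    then show "\<bar>H (x - j) * G (x - j) * (l ^ j / fact j)\<bar> \<le> M * (H (x - j) * (l ^ j / fact j))"
      using assms by (simp add: abs_mult mult_ac)
  qed
  then show ?thesis by (simp add: exp_conv_def sum_distrib_left)
qed

context poisson_flow
begin

definition flows :: "(real \<Rightarrow> nat \<Rightarrow> real) \<Rightarrow> bool" where
  "flows h \<longleftrightarrow> (\<forall>t\<ge>0. \<forall>x. ((\<lambda>s. h s x) has_real_derivative
      \<alpha> t * (h t x - shift_down (h t) x)) (at t within {0..}))"

text \<open>
  The factor accounts for the term \<open>\<alpha> t * h t x\<close> of the equation, which acts on every coordinate alike;
  what remains is the shift, solved by \<open>exp_conv\<close>.
\<close>
definition solution :: "real \<Rightarrow> (nat \<Rightarrow> real) \<Rightarrow> real \<Rightarrow> nat \<Rightarrow> real" where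
  "solution T H t x = exp (clock t - clock T) * exp_conv (clock T - clock t) H x"

lemma flows_solution: "flows (solution T H)"
  unfolding flows_def
proof (intro allI impI)
  fix t :: real and x assume t: "t \<ge> 0"
  have "((\<lambda>s. exp_conv (clock T - clock s) H x) has_real_derivative
      shift_down (exp_conv (clock T - clock t) H) x * (0 - \<alpha> t)) (at t within {0..})"
    by (rule DERIV_chain2[OF exp_conv_has_derivative DERIV_diff[OF DERIV_const clock_deriv[OF t]]])
  moreover have "((\<lambda>s. exp (clock s - clock T)) has_real_derivative exp (clock t - clock T) * \<alpha> t) (at t within {0..})"
    by (rule derivative_eq_intros clock_deriv[OF t] refl)+ simp
  ultimately have "((\<lambda>s. solution T H s x) has_real_derivative
      exp (clock t - clock T) * \<alpha> t * exp_conv (clock T - clock t) H x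
      + shift_down (exp_conv (clock T - clock t) H) x * (0 - \<alpha> t) * exp (clock t - clock T)) (at t within {0..})"
    unfolding solution_def by (rule DERIV_mult[rotated])
  then show "((\<lambda>s. solution T H s x) has_real_derivative
      \<alpha> t * (solution T H t x - shift_down (solution T H t) x)) (at t within {0..})"
    by (rule DERIV_cong) (simp add: solution_def shift_down_def algebra_simps)
qed

lemma flows_diff: "flows h \<Longrightarrow> flows h' \<Longrightarrow> flows (\<lambda>t x. h t x - h' t x)"
  unfolding flows_def
  by (auto intro!: DERIV_cong[OF DERIV_diff] simp: shift_down_def algebra_simps)

text \<open>
  The system is triangular: once the coordinate \<open>x - 1\<close> vanishes, coordinate \<open>x\<close> is a multiple of
  \<open>exp (clock t)\<close>, and its value at \<open>T\<close> makes it zero.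
\<close>
lemma flows_eq_0:
  assumes h: "flows h" and T: "T \<ge> 0" "\<And>x. h T x = 0" and t: "t \<ge> 0"
  shows "h t x = 0"
proof -
  have *: "h t x = 0" if prev: "\<And>s. s \<ge> 0 \<Longrightarrow> shift_down (h s) x = 0" and t: "t \<ge> 0" for t x
  proof -
    have "((\<lambda>s. h s x * exp (- clock s)) has_real_derivative 0) (at s within {0..})" if s: "s \<in> {0..}" for s
    proof -
      have "((\<lambda>s. h s x) has_real_derivative \<alpha> s * (h s x - shift_down (h s) x)) (at s within {0..})"
        using h s by (simp add: flows_def)
      then have "((\<lambda>s. h s x) has_real_derivative \<alpha> s * h s x) (at s within {0..})"
        using prev[of s] s by simp
      moreover have "((\<lambda>s. exp (- clock s)) has_real_derivative exp (- clock s) * - \<alpha> s) (at s within {0..})"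
        by (rule derivative_eq_intros clock_deriv refl)+ (use s in auto)
      ultimately show ?thesis
        by (rule DERIV_cong[OF DERIV_mult]) simp
    qed
    then obtain k where "\<forall>s\<in>{0..}. h s x * exp (- clock s) = k"
      using has_field_derivative_zero_constant[of "{0..}" "\<lambda>s. h s x * exp (- clock s)"] by auto
    then have "h t x * exp (- clock t) = k" "h T x * exp (- clock T) = k" using T(1) t by auto
    then show ?thesis using T(2)[of x] by simp
  qed
  show ?thesis
    using t
  proof (induction x arbitrary: t)
    case 0
    show ?case using *[of 0 t] 0 by (simp add: shift_down_def)
  next
    case (Suc x)
    show ?case using *[of "Suc x" t] Suc by (simp add: shift_down_def)
  qed
qed

lemma flows_eq_solution:
  assumes "flows h" "T \<ge> 0" "t \<ge> 0"
  shows "h t x = solution T (h T) t x"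
  using flows_eq_0[OF flows_diff[OF assms(1) flows_solution[of T "h T"]] assms(2) _ assms(3)]
  by (simp add: solution_def exp_conv_0)

lemma flows_V: "flows (\<lambda>t. pmf (V t))"
  unfolding flows_def using V_deriv by blast

lemma clock_mono:
  assumes "0 \<le> t" "t \<le> T"
  shows "clock t \<le> clock T"
  by (rule increasing_of_deriv_nonneg[OF assms(2) DERIV_subset[OF clock_deriv]])
    (use assms \<alpha>_pos in \<open>auto intro: less_imp_le\<close>)

text \<open>
  Converse of the product rule for \<open>V t x * g t x\<close>: dividing any solution by \<open>V\<close> gives an
  admissible \<open>g\<close>.
\<close>
lemma conditioned_flow_quotient:
  assumes h: "flows h"
  shows "conditioned_flow V \<alpha> (\<lambda>t x. h t x / pmf (V t) x)"
proof unfold_locales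
  fix t :: real and x assume t: "t \<ge> 0"
  let ?v = "pmf (V t)"
  have pos: "?v y > 0" for y using V_pos[OF t] .
  have h': "((\<lambda>s. h s x) has_real_derivative \<alpha> t * (h t x - shift_down (h t) x)) (at t within {0..})"
    using h t by (simp add: flows_def)
  have s: "shift_down ?v x * (h t (x - 1) / ?v (x - 1)) = shift_down (h t) x"
    using pos[of "x - 1"] by (simp add: shift_down_def)
  have "shift_down ?v x / ?v x * (h t x / ?v x - h t (x - 1) / ?v (x - 1))
      = (shift_down ?v x * h t x / ?v x - shift_down ?v x * (h t (x - 1) / ?v (x - 1))) / ?v x"
    using pos[of x] by (simp add: field_simps)
  then have "((\<alpha> t * (h t x - shift_down (h t) x)) * ?v x - h t x * (\<alpha> t * (?v x - shift_down ?v x)))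
      / (?v x * ?v x)
      = \<alpha> t * (shift_down ?v x / ?v x) * (h t x / ?v x - h t (x - 1) / ?v (x - 1))"
    unfolding s mult.assoc using pos[of x] by (simp add: field_simps)
  then show "((\<lambda>s. h s x / pmf (V s) x) has_real_derivative
      \<alpha> t * (shift_down ?v x / ?v x) * (h t x / ?v x - h t (x - 1) / ?v (x - 1))) (at t within {0..})"
    using DERIV_divide[OF h' V_deriv[OF t, of x]] pos[of x] by simp
qed

end

context conditioned_flow
begin

lemma flows_density: "flows (\<lambda>t x. pmf (V t) x * g t x)"
  unfolding flows_def
proof (intro allI impI)
  fix t :: real and x assume t: "t \<ge> 0"
  have s: "shift_down (\<lambda>x. pmf (V t) x * g t x) x = shift_down (pmf (V t)) x * g t (x - 1)"
    by (simp add: shift_down_def)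
  show "((\<lambda>s. pmf (V s) x * g s x) has_real_derivative
      \<alpha> t * (pmf (V t) x * g t x - shift_down (\<lambda>x. pmf (V t) x * g t x) x)) (at t within {0..})"
    unfolding s
    by (rule DERIV_cong[OF DERIV_mult[OF V_deriv[OF t] g_deriv[OF t]]])
      (use V_pos[OF t, of x] in \<open>simp add: field_simps\<close>)
qed

text \<open>
  The solution whose value at time \<open>T\<close> is that of \<open>g\<close> on \<open>{0..n}\<close> and \<open>0\<close> beyond.
\<close>
definition truncated :: "real \<Rightarrow> nat \<Rightarrow> real \<Rightarrow> nat \<Rightarrow> real" where
  "truncated T n t x =
     solution T (\<lambda>y. pmf (V T) y * (if y \<le> n then g T y else 0)) t x / pmf (V t) x"

text \<open>
  The convolution at \<open>x\<close> involves only the values at \<open>y \<le> x\<close>.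
\<close>
lemma truncated_eq:
  assumes "T \<ge> 0" "t \<ge> 0" "x \<le> n"
  shows "truncated T n t x = g t x"
proof -
  have "solution T (\<lambda>y. pmf (V T) y * (if y \<le> n then g T y else 0)) t x
      = solution T (\<lambda>y. pmf (V T) y * g T y) t x"
    unfolding solution_def using assms(3) by (intro arg_cong2[of _ _ _ _ times] exp_conv_cong) auto
  also have "\<dots> = pmf (V t) x * g t x"
    using flows_eq_solution[OF flows_density assms(1,2), of x] by simp
  finally show ?thesis using V_pos[OF assms(2), of x] by (simp add: truncated_def)
qed

lemma truncated_final: "T \<ge> 0 \<Longrightarrow> truncated T n T x = (if x \<le> n then g T x else 0)"
  using V_pos[of T x] by (simp add: truncated_def solution_def exp_conv_0)

text \<open>
  Up to time \<open>T\<close> the Poisson weights are nonnegative, so conditional expectations preserve the bound at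
  time \<open>T\<close>.
\<close>
lemma bounded_flow_truncated:
  assumes T: "T \<ge> 0"
  shows "bounded_flow V \<alpha> (truncated T n) T (\<Sum>y\<le>n. \<bar>g T y\<bar>)"
proof -
  define G where "G y = (if y \<le> n then g T y else 0)" for y
  define M where "M = (\<Sum>y\<le>n. \<bar>g T y\<bar>)"
  interpret tr: conditioned_flow V \<alpha> "truncated T n"
    unfolding truncated_def by (rule conditioned_flow_quotient[OF flows_solution])
  show ?thesis
    unfolding M_def[symmetric]
  proof unfold_locales
    show "T \<ge> 0" by fact
    fix t x assume t: "t \<in> {0..T}"
    have "\<bar>G y\<bar> \<le> M" for y
    proof (cases "y \<le> n")
      case True
      then show ?thesis
        using member_le_sum[of y "{..n}" "\<lambda>y. \<bar>g T y\<bar>"] by (simp add: G_def M_def)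
    qed (simp add: G_def M_def sum_nonneg)
    then have "\<bar>exp_conv (clock T - clock t) (\<lambda>y. pmf (V T) y * G y) x\<bar>
        \<le> M * exp_conv (clock T - clock t) (pmf (V T)) x"
      using clock_mono[of t T] t by (intro abs_exp_conv_mult_le) auto
    then have "\<bar>solution T (\<lambda>y. pmf (V T) y * G y) t x\<bar> \<le> M * solution T (pmf (V T)) t x"
      by (simp add: solution_def abs_mult mult.left_commute)
    also have "solution T (pmf (V T)) t x = pmf (V t) x"
      using flows_eq_solution[OF flows_V T, of t x] t by simp
    finally show "\<bar>truncated T n t x\<bar> \<le> M"
      using V_pos[of t x] t by (simp add: truncated_def G_def[symmetric] divide_le_eq)
  qed
qed

text \<open>
  At time \<open>T\<close> the truncated function contributes \<open>exp 0 = 1\<close> at every point beyond \<open>n\<close>, which produces the tail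
  mass of \<open>V T\<close> on the right.
\<close>
lemma partial_exponential_moment_le:
  fixes c :: "real \<Rightarrow> real" and p q T :: real
  assumes q: "q = p * exp (- integral {0..T} (\<lambda>s. \<alpha> s * c s))"
    and T: "T \<ge> 0" and p: "p > 0"
    and c_pos: "\<And>t. t \<in> {0..T} \<Longrightarrow> c t > 0"
    and log_sobolev: "\<And>t (f :: nat \<Rightarrow> real).
          t \<in> {0..T} \<Longrightarrow> (\<And>x. f x > 0) \<Longrightarrow> summable (\<lambda>x. pmf (V t) x * f x) \<Longrightarrow>
          pmf_Ent (V t) f \<le> ereal (1 / c t) *
            (\<Sum>x. ereal (pmf (V t) x * f (x + 1) *
               (ln (f (x + 1) / f x) - 1 + f x / f (x + 1))))"
    and integrable: "(\<lambda>s. \<alpha> s * c s) integrable_on {0..T}"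
  shows "(\<Sum>x\<le>n. pmf (V 0) x * exp (p * g 0 x))
    \<le> ((\<Sum>x\<le>n. pmf (V T) x * exp (q * g T x)) + (1 - (\<Sum>x\<le>n. pmf (V T) x))) powr (p / q)"
proof -
  interpret tr: bounded_flow V \<alpha> "truncated T n" T "\<Sum>y\<le>n. \<bar>g T y\<bar>"
    by (rule bounded_flow_truncated[OF T])
  have "(\<Sum>x\<le>n. pmf (V 0) x * exp (p * g 0 x))
      = (\<Sum>x\<le>n. pmf (V 0) x * exp (p * truncated T n 0 x))"
    using truncated_eq[OF T, of 0] by simp
  also have "\<dots> \<le> (\<Sum>x. pmf (V 0) x * exp (p * truncated T n 0 x))"
    using tr.summable_summand[of 0 p] T
    by (intro sum_le_suminf) (auto simp: tr.summand_def)
  also have "\<dots> \<le> (\<Sum>x. pmf (V T) x * exp (q * truncated T n T x)) powr (p / q)"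
    unfolding q using p c_pos log_sobolev integrable by (rule tr.exponential_moment_le_if_bounded)
  also have "(\<Sum>x. pmf (V T) x * exp (q * truncated T n T x))
      = (\<Sum>x\<le>n. pmf (V T) x * exp (q * g T x)) + (1 - (\<Sum>x\<le>n. pmf (V T) x))"
  proof -
    have "(\<lambda>x. if x \<in> {..n} then pmf (V T) x * exp (q * g T x) - pmf (V T) x else 0)
        sums (\<Sum>x\<le>n. pmf (V T) x * exp (q * g T x) - pmf (V T) x)"
      by (rule sums_If_finite_set) simp
    moreover have "pmf (V T) sums 1"
      using summable_sums[OF summable_pmf[of "V T"]] suminf_pmf[of "V T"] by simp
    ultimately have "(\<lambda>x. (if x \<in> {..n} then pmf (V T) x * exp (q * g T x) - pmf (V T) x else 0)
        + pmf (V T) x) sums ((\<Sum>x\<le>n. pmf (V T) x * exp (q * g T x) - pmf (V T) x) + 1)"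
      by (rule sums_add)
    also have "(\<lambda>x. (if x \<in> {..n} then pmf (V T) x * exp (q * g T x) - pmf (V T) x else 0)
        + pmf (V T) x) = (\<lambda>x. pmf (V T) x * exp (q * truncated T n T x))"
      by (auto simp: truncated_final[OF T])
    finally show ?thesis by (simp add: sums_iff sum_subtractf)
  qed
  finally show ?thesis .
qed

end


section \<open>The norm inequality\<close>
lemma pmf_norm_exp:
  assumes "summable (\<lambda>x. pmf U x * exp (r * h x))"
  shows "pmf_norm U r (\<lambda>x. exp (h x)) = ennreal ((\<Sum>x. pmf U x * exp (r * h x)) powr (1 / r))"
proof -
  have "(\<Sum>x. ennreal (pmf U x * exp (h x) powr r)) = (\<Sum>x. ennreal (pmf U x * exp (r * h x)))"
    by (simp add: exp_powr_real mult.commute)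
  also have "\<dots> = ennreal (\<Sum>x. pmf U x * exp (r * h x))"
    by (rule suminf_ennreal2[OF _ assms]) simp
  finally show ?thesis
    unfolding pmf_norm_def ennreal_powr_def by (simp add: suminf_nonneg[OF assms])
qed

lemma pmf_norm_exp_infinite:
  assumes "\<not> summable (\<lambda>x. pmf U x * exp (r * h x))"
  shows "pmf_norm U r (\<lambda>x. exp (h x)) = \<top>"
proof -
  have "(\<Sum>x. ennreal (pmf U x * exp (h x) powr r)) = (\<Sum>x. ennreal (pmf U x * exp (r * h x)))"
    by (simp add: exp_powr_real mult.commute)
  also have "\<dots> = \<top>"
    by (rule ccontr) (rule notE[OF assms summable_suminf_not_top], simp_all)
  finally show ?thesis by (simp add: pmf_norm_def ennreal_powr_def)
qed

theorem proposition8p5: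
  fixes V :: "real \<Rightarrow> nat pmf"
    and g :: "real \<Rightarrow> nat \<Rightarrow> real"
    and \<alpha> c q :: "real \<Rightarrow> real"
    and p :: real
  assumes V_pos: "\<And>t x. t \<ge> 0 \<Longrightarrow> pmf (V t) x > 0"
    and \<alpha>_pos: "\<And>t. t \<ge> 0 \<Longrightarrow> \<alpha> t > 0"
    and V_deriv: "\<And>t x. t \<ge> 0 \<Longrightarrow>
          ((\<lambda>s. pmf (V s) x) has_real_derivative
             \<alpha> t * (pmf (V t) x - shift_down (pmf (V t)) x)) (at t within {0..})"
    and g_deriv: "\<And>t x. t \<ge> 0 \<Longrightarrow>
          ((\<lambda>s. g s x) has_real_derivative
             \<alpha> t * (shift_down (pmf (V t)) x / pmf (V t) x) * (g t x - g t (x - 1)))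
            (at t within {0..})"
    and c_pos: "\<And>t. t \<ge> 0 \<Longrightarrow> c t > 0"
    and log_sobolev: "\<And>t (f :: nat \<Rightarrow> real).
          t \<ge> 0 \<Longrightarrow> (\<And>x. f x > 0) \<Longrightarrow> summable (\<lambda>x. pmf (V t) x * f x) \<Longrightarrow>
          pmf_Ent (V t) f \<le> ereal (1 / c t) *
            (\<Sum>x. ereal (pmf (V t) x * f (x + 1) *
               (ln (f (x + 1) / f x) - 1 + f x / f (x + 1))))"
    and \<alpha>c_integrable: "\<And>t. t \<ge> 0 \<Longrightarrow> (\<lambda>s. \<alpha> s * c s) integrable_on {0..t}"
    and p_pos: "p > 0"
    and q_def: "\<And>t. t \<ge> 0 \<Longrightarrow> q t = p * exp (- integral {0..t} (\<lambda>s. \<alpha> s * c s))"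
  shows "\<forall>t\<ge>0. pmf_norm (V 0) p (\<lambda>x. exp (g 0 x))
                 \<le> pmf_norm (V t) (q t) (\<lambda>x. exp (g t x))"
proof (intro allI impI)
  fix T :: real assume T: "T \<ge> 0"
  interpret conditioned_flow V \<alpha> g
    by unfold_locales (fact V_pos \<alpha>_pos V_deriv g_deriv)+
  have q: "q T > 0" using p_pos by (simp add: q_def[OF T])
  let ?f = "\<lambda>x. pmf (V 0) x * exp (p * g 0 x)" and ?h = "\<lambda>x. pmf (V T) x * exp (q T * g T x)"
  show "pmf_norm (V 0) p (\<lambda>x. exp (g 0 x)) \<le> pmf_norm (V T) (q T) (\<lambda>x. exp (g T x))"
  proof (cases "summable ?h")
    case False
    then show ?thesis by (simp add: pmf_norm_exp_infinite)
  next
    case True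
    have h_pos: "suminf ?h > 0"
      by (rule suminf_pos[OF True]) (use V_pos[OF T] in auto)
    have "(\<lambda>n. sum ?h {..n}) \<longlonglongrightarrow> suminf ?h" by (rule summable_LIMSEQ'[OF True])
    moreover have "(\<lambda>n. \<Sum>x\<le>n. pmf (V T) x) \<longlonglongrightarrow> 1"
      using summable_LIMSEQ'[OF summable_pmf[of "V T"]] by (simp add: suminf_pmf)
    ultimately have "(\<lambda>n. sum ?h {..n} + (1 - (\<Sum>x\<le>n. pmf (V T) x))) \<longlonglongrightarrow> suminf ?h + (1 - 1)"
      by (intro tendsto_intros)
    then have lim: "(\<lambda>n. (sum ?h {..n} + (1 - (\<Sum>x\<le>n. pmf (V T) x))) powr (p / q T))
        \<longlonglongrightarrow> suminf ?h powr (p / q T)"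
      using h_pos by (intro tendsto_powr) auto
    have partial: "sum ?f {..n} \<le> (sum ?h {..n} + (1 - (\<Sum>x\<le>n. pmf (V T) x))) powr (p / q T)" for n
      by (rule partial_exponential_moment_le[OF q_def[OF T] T p_pos c_pos log_sobolev \<alpha>c_integrable[OF T]]) auto
    have bound: "sum ?f {..m} \<le> suminf ?h powr (p / q T)" for m
    proof (rule LIMSEQ_le_const[OF lim], intro exI allI impI)
      fix n assume "m \<le> n"
      then have "sum ?f {..m} \<le> sum ?f {..n}" by (intro sum_mono2) auto
      then show "sum ?f {..m} \<le> (sum ?h {..n} + (1 - (\<Sum>x\<le>n. pmf (V T) x))) powr (p / q T)"
        using partial[of n] by simp
    qed
    have f: "summable ?f"
      by (rule bounded_imp_summable[OF _ bound]) simp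
    have "suminf ?f \<le> suminf ?h powr (p / q T)"
      by (rule LIMSEQ_le_const2[OF summable_LIMSEQ'[OF f]]) (use bound in auto)
    then have "suminf ?f powr (1 / p) \<le> (suminf ?h powr (p / q T)) powr (1 / p)"
      using p_pos suminf_nonneg[OF f] by (intro powr_mono2) auto
    also have "\<dots> = suminf ?h powr (1 / q T)"
      using p_pos by (simp add: powr_powr)
    finally show ?thesis
      by (simp add: pmf_norm_exp[OF f] pmf_norm_exp[OF True] ennreal_leI)
  qed
qed

end
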